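(* Let $\mathcal{P}$ be a regular $3$-polytope with $E$ edges and $V$ vertices inscribed in a unit $3$-sphere. Then $$\prod_{i=1}^{N}c_i^2=\frac{\nu^{a}}{\varepsilon^{b}},$$ where $N$ is the total number of chords of $\mathcal{P}$, $c_i$ is the length of the $i$-th chord of $\mathcal{P}$, $\nu$ is the number of vertices incident to any edge, $\varepsilon$ is the number of edges incident to any vertex, and $a,b$ are positive integers such that $E$ divides $b$ and 1. for the self-dual tetrahedron, $a\equiv 0\pmod E$ and $a\equiv E\pmod V$; 2. for the dual pair of octahedron and cube, $a\equiv V\pmod E$ and $a\equiv E\pmod V$; and 3. for the dual pair of icosahedron and dodecahedron, $a\equiv V\pmod E$ and $a\equiv 0\pmod V$. In addition, the number $\varepsilon$ in the equation above may be replaced by $$\frac{E}{(E,V)}=\frac{[E,V]}{V},$$ where $(E,V)$ is the greatest common divisor of $E$ and $V$ and $[E,V]$ is the least common multiple of $E$ and $V$.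
   Context: A regular $3$-polytope is one of the five regular convex polyhedra (tetrahedron, octahedron, cube, icosahedron, dodecahedron, all regular). A unit $3$-sphere means a sphere of radius $1$ in Euclidean $3$-space, and the polytope is inscribed in it if all its vertices lie on the sphere. A chord of the polytope is a line segment whose endpoints are two distinct vertices of the polytope, so the chords are all of its edges and diagonals; the product runs over all chords, each counted once. *)

theory Defs
  imports "HOL-Analysis.Analysis" "HOL-Number_Theory.Cong"
begin

definition vertices :: "(real^3) set \<Rightarrow> (real^3) set" where
  "vertices P = {v. v extreme_point_of P}"

definition edges :: "(real^3) set \<Rightarrow> (real^3) set set" where
  "edges P = {e. e edge_of P}"

(* Chords are segments, i.e. point sets, so a segment does not depend on the order of its
   endpoints; its length is its diameter. *)

definition chords :: "(real^3) set \<Rightarrow> (real^3) set set" where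
  "chords P = {closed_segment u v | u v. u \<in> vertices P \<and> v \<in> vertices P \<and> u \<noteq> v}"

definition chord_length :: "(real^3) set \<Rightarrow> real" where
  "chord_length c = diameter c"

definition inscribed_in_unit_sphere :: "(real^3) set \<Rightarrow> bool" where
  "inscribed_in_unit_sphere P \<longleftrightarrow> (\<exists>x. vertices P \<subseteq> sphere x 1)"

(* The five regular polyhedra are given as the sets similar to a standard model: any position,
   orientation and size is allowed. The models have the usual coordinates, centred at the origin. *)

definition similar :: "(real^3) set \<Rightarrow> (real^3) set \<Rightarrow> bool" where
  "similar P Q \<longleftrightarrow>
    (\<exists>f r. 0 < r \<and> (\<forall>x y. dist (f x) (f y) = r * dist x y) \<and> P = f ` Q)"

definition golden_ratio :: real where
  "golden_ratio = (1 + sqrt 5) / 2"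

definition cyclic_permutations :: "real \<Rightarrow> real \<Rightarrow> real \<Rightarrow> (real^3) set" where
  "cyclic_permutations x y z = {vector [x, y, z], vector [y, z, x], vector [z, x, y]}"

definition regular_tetrahedron :: "(real^3) set \<Rightarrow> bool" where
  "regular_tetrahedron P \<longleftrightarrow>
    similar P (convex hull (insert (vector [1, 1, 1]) (cyclic_permutations 1 (-1) (-1))))"

definition regular_octahedron :: "(real^3) set \<Rightarrow> bool" where
  "regular_octahedron P \<longleftrightarrow>
    similar P (convex hull (\<Union>s\<in>{-1, 1}. cyclic_permutations s 0 0))"

definition cube_vertices :: "(real^3) set" where
  "cube_vertices = {vector [s, t, u] | s t u. s \<in> {-1, 1} \<and> t \<in> {-1, 1} \<and> u \<in> {-1, 1}}"

definition regular_cube :: "(real^3) set \<Rightarrow> bool" where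
  "regular_cube P \<longleftrightarrow> similar P (convex hull cube_vertices)"

definition regular_icosahedron :: "(real^3) set \<Rightarrow> bool" where
  "regular_icosahedron P \<longleftrightarrow>
    similar P (convex hull
      (\<Union>s\<in>{-1, 1}. \<Union>t\<in>{-1, 1}. cyclic_permutations 0 s (t * golden_ratio)))"

definition regular_dodecahedron :: "(real^3) set \<Rightarrow> bool" where
  "regular_dodecahedron P \<longleftrightarrow>
    similar P (convex hull
      (cube_vertices \<union>
       (\<Union>s\<in>{-1, 1}. \<Union>t\<in>{-1, 1}.
          cyclic_permutations 0 (s / golden_ratio) (t * golden_ratio))))"

definition regular_3_polytope :: "(real^3) set \<Rightarrow> bool" where
  "regular_3_polytope P \<longleftrightarrow>
    regular_tetrahedron P \<or> regular_octahedron P \<or> regular_cube P \<or>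
    regular_icosahedron P \<or> regular_dodecahedron P"

end

theory Submission
  imports Defs
begin

text \<open>
The vertex sets of the five solids share two features. They lie on a sphere, and every vertex sees the
other vertices at the same multiset of squared distances. The second feature gives the product of the
chords almost for free: the product of the squared lengths over ordered pairs of vertices is the square
of the product over chords, and it is also the product \<open>\<Prod>M\<close> of the common multiset \<open>M\<close>, raised to the
power \<open>V\<close> (\<open>chord_product\<close>). On the unit sphere \<open>\<Prod>M\<close> is the quotient of a power
of \<open>\<nu> = 2\<close> by a power of \<open>\<epsilon>\<close>, which is the shape that the theorem claims.

The numbers \<open>\<nu>\<close>, \<open>\<epsilon>\<close> and \<open>E\<close> need the edges of the convex hull, and these are exactly the segments
between closest vertices. A closest pair \<open>u, v\<close> of a finite set on a sphere around \<open>c\<close> always spans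
an edge, because the functional with normal \<open>(u - c) + (v - c)\<close> is maximal on \<open>u\<close> and \<open>v\<close> only
(\<open>closest_pair_edge_of_convex_hull\<close>). A pair at any other distance spans no edge, because it
meets the segment between two other vertices
(\<open>crossed_segment_not_edge_of\<close>). So \<open>\<epsilon>\<close> is the multiplicity of the least squared distance in \<open>M\<close>, and
counting incidences gives \<open>2 E = V \<epsilon>\<close>.

All these hypotheses speak of distances only, since betweenness is the equality case of the triangle
inequality. They therefore pass from the standard models to every similar solid (\<open>similar_image\<close>), and
the scaling factor is forced by the unit sphere because a full-dimensional set has at most one circumcentre
(\<open>similarity_circumradius\<close>).

For the models themselves the hypotheses are finite computations in the ring \<open>\<int>[\<phi>]\<close>, where \<open>\<phi>\<close> is the
golden ratio. They are carried out with pairs of integers. The products of squared chord lengths come out as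
\<open>2^18 / 3^6\<close>, \<open>2^18\<close>, \<open>2^68 / 3^24\<close>, \<open>2^132 / 5^30\<close> and \<open>2^440 / 3^180\<close> for tetrahedron, octahedron, cube,
icosahedron and dodecahedron. In all cases but the octahedron \<open>\<epsilon> = E / gcd E V\<close>. For the octahedron
the two numbers are \<open>4\<close> and \<open>2\<close>, powers of \<open>\<nu> = 2\<close>, so the fraction can be expanded to make the
exponent \<open>b\<close> positive and divisible by \<open>E = 12\<close>.
\<close>

section \<open>Segments and similarities\<close>

lemma diameter_closed_segment:
  fixes a b :: "'a::euclidean_space"
  shows "diameter (closed_segment a b) = dist a b"
proof (rule antisym)
  show "diameter (closed_segment a b) \<le> dist a b"
  proof (rule diameter_le)
    fix x y assume x: "x \<in> closed_segment a b" and y: "y \<in> closed_segment a b"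
    have "dist x y \<le> dist x a \<or> dist x y \<le> dist x b"
      using dist_decreases_closed_segment[OF y, of x] by simp
    then show "norm (x - y) \<le> dist a b"
      using dist_in_closed_segment[OF x] by (auto simp: dist_norm)
  qed simp
  show "dist a b \<le> diameter (closed_segment a b)"
    by (rule diameter_bounded_bound) (auto simp: bounded_closed_segment)
qed

text \<open>
A map that scales all distances by the same factor is affine: after subtracting its value at \<open>0\<close> it is linear.
\<close>
lemma similarity_image_convex_hull:
  fixes f :: "'a::euclidean_space \<Rightarrow> 'a"
  assumes f: "\<forall>x y. dist (f x) (f y) = r * dist x y"
  shows "f ` (convex hull S) = convex hull (f ` S)"
proof -
  let ?g = "\<lambda>x. f x - f 0"
  have "linear ?g"
    by (rule scaling_linear[where c = r]) (use f in \<open>auto simp: dist_norm\<close>)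
  then have g: "?g ` (convex hull S) = convex hull (?g ` S)"
    by (rule convex_hull_linear_image)
  have shift: "f ` A = (\<lambda>x. f 0 + x) ` ?g ` A" for A
    by (simp add: image_image)
  show ?thesis
    unfolding shift[of "convex hull S"] shift[of S] g by (simp add: convex_hull_translation)
qed

section \<open>Edges of the convex hull of points on a sphere\<close>

lemma sphere_Int_closed_segment:
  fixes u v :: "'a::euclidean_space"
  assumes "u \<in> sphere c \<rho>" "v \<in> sphere c \<rho>" "w \<in> sphere c \<rho>" "w \<in> closed_segment u v"
  shows "w \<in> {u, v}"
  using assms dist_decreases_open_segment[of w u v c] by (auto simp: closed_segment_eq_open)

text \<open>
The hull lies in the ball, and the ball is strictly convex, so no point of the sphere is
inside a segment of the hull.
\<close>
lemma extreme_points_convex_hull_sphere: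
  fixes T :: "'a::euclidean_space set"
  assumes "T \<subseteq> sphere c \<rho>"
  shows "{v. v extreme_point_of (convex hull T)} = T"
proof -
  have ball: "convex hull T \<subseteq> cball c \<rho>"
    using assms by (intro hull_minimal) auto
  have "v extreme_point_of (convex hull T)" if v: "v \<in> T" for v
  proof -
    have "v \<notin> open_segment a b" if "a \<in> convex hull T" "b \<in> convex hull T" for a b
      using that ball v assms dist_decreases_open_segment[of v a b c] by force
    then show ?thesis
      using v by (simp add: extreme_point_of_def hull_inc)
  qed
  then show ?thesis
    using extreme_point_of_convex_hull by blast
qed

text \<open>
An edge is the hull of a collinear set of the given points, and a line meets a sphere at most twice.
\<close>
lemma edge_of_convex_hull_sphereE:
  fixes T :: "'a::euclidean_space set"
  assumes fin: "finite T" and T: "T \<subseteq> sphere c \<rho>" and e: "e edge_of (convex hull T)"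
  obtains u v where "u \<in> T" "v \<in> T" "u \<noteq> v" "e = closed_segment u v"
proof -
  have face: "e face_of (convex hull T)" and dim: "aff_dim e = 1"
    using e by (auto simp: edge_of_def)
  obtain A where A: "A \<subseteq> T" "e = convex hull A"
    using face_of_convex_hull_subset[OF finite_imp_compact[OF fin] face] by blast
  have dimA: "aff_dim A = 1"
    using dim A by (simp add: aff_dim_convex_hull)
  then obtain u where u: "u \<in> A"
    by fastforce
  moreover have "A \<noteq> {u}"
    using dimA by auto
  ultimately obtain v where v: "v \<in> A" "v \<noteq> u"
    by blast
  have "w \<in> {u, v}" if w: "w \<in> A" for w
  proof -
    have "collinear {u, v, w}"
      using dimA u v w by (intro collinear_subset[of A "{u, v, w}"]) (simp_all add: collinear_aff_dim)
    then have "u \<in> closed_segment v w \<or> v \<in> closed_segment w u \<or> w \<in> closed_segment u v"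
      by (simp add: collinear_between_cases between_mem_segment)
    moreover have "u \<in> sphere c \<rho>" "v \<in> sphere c \<rho>" "w \<in> sphere c \<rho>"
      using u v w A T by auto
    ultimately show ?thesis
      using sphere_Int_closed_segment v by blast
  qed
  then have "A = {u, v}"
    using u v by blast
  then show ?thesis
    using that[of u v] u v A by (auto simp: segment_convex_hull)
qed

text \<open>
On a sphere of radius \<open>\<rho>\<close> around \<open>c\<close>, inner products and distances determine each other:
\<open>(w - c) \<bullet> (x - c) = \<rho>\<^sup>2 - (dist w x)\<^sup>2 / 2\<close>. Hence the functional with normal \<open>(u - c) + (v - c)\<close> takes the
value \<open>2 \<rho>\<^sup>2 - d / 2\<close> at \<open>u\<close> and \<open>v\<close>, up to a common constant, where \<open>d\<close> is the squared distance of \<open>u\<close> and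
\<open>v\<close>. At any other point it is at most \<open>2 \<rho>\<^sup>2 - d\<close> if no two points are closer than \<open>u\<close> and \<open>v\<close>. The
segment is therefore an exposed face.
\<close>
lemma closest_pair_edge_of_convex_hull:
  fixes T :: "'a::euclidean_space set"
  assumes fin: "finite T" and T: "T \<subseteq> sphere c \<rho>" and uv: "u \<in> T" "v \<in> T" "u \<noteq> v"
    and closest: "\<And>x y. x \<in> T \<Longrightarrow> y \<in> T \<Longrightarrow> x \<noteq> y \<Longrightarrow> dist u v \<le> dist x y"
  shows "closed_segment u v edge_of (convex hull T)"
proof -
  define d where "d = (dist u v)\<^sup>2"
  define a where "a = (u - c) + (v - c)"
  define b where "b = a \<bullet> c + 2 * \<rho>\<^sup>2 - d / 2"
  have ax: "a \<bullet> x = a \<bullet> c + 2 * \<rho>\<^sup>2 - ((dist u x)\<^sup>2 + (dist v x)\<^sup>2) / 2" if x: "x \<in> T" for x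
  proof -
    have inner: "(w - c) \<bullet> (x - c) = \<rho>\<^sup>2 - (dist w x)\<^sup>2 / 2" if "w \<in> T" for w
    proof -
      have "norm (w - c) = \<rho>" "norm (x - c) = \<rho>"
        using T x that by (auto simp: dist_norm norm_minus_commute)
      moreover have "dist w x = norm ((w - c) - (x - c))"
        by (simp add: dist_norm)
      ultimately show ?thesis
        using dot_norm_neg[of "w - c" "x - c"] by (simp add: field_simps)
    qed
    have "a \<bullet> x - a \<bullet> c = (u - c) \<bullet> (x - c) + (v - c) \<bullet> (x - c)"
      by (simp add: a_def inner_diff_right inner_add_left)
    then show ?thesis
      using inner[OF uv(1)] inner[OF uv(2)] by (simp add: field_simps)
  qed
  have far: "d \<le> (dist w x)\<^sup>2" if "w \<in> T" "x \<in> T" "w \<noteq> x" for w x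
    unfolding d_def using closest[OF that] by (intro power_mono) auto
  have dpos: "0 < d"
    using uv by (simp add: d_def)
  have le: "a \<bullet> x \<le> b" and eq: "a \<bullet> x = b \<Longrightarrow> x \<in> {u, v}" if x: "x \<in> T" for x
  proof -
    have "a \<bullet> x < b" if "x \<notin> {u, v}"
    proof -
      have "u \<noteq> x" "v \<noteq> x"
        using that by auto
      then show ?thesis
        using far[OF uv(1) x] far[OF uv(2) x] dpos by (simp add: ax[OF x] b_def)
    qed
    moreover have on: "a \<bullet> x = b" if "x \<in> {u, v}"
      using that by (auto simp: ax[OF x] b_def d_def dist_commute)
    ultimately show "a \<bullet> x \<le> b" "a \<bullet> x = b \<Longrightarrow> x \<in> {u, v}"
      by fastforce+
  qed
  have on: "a \<bullet> u = b" "a \<bullet> v = b"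
    by (simp_all add: ax uv b_def d_def dist_commute)
  let ?F = "(convex hull T) \<inter> {x. a \<bullet> x = b}"
  have "convex hull T \<subseteq> {x. a \<bullet> x \<le> b}"
    using le by (intro hull_minimal) (auto simp: convex_halfspace_le)
  then have face: "?F face_of (convex hull T)"
    by (intro face_of_Int_supporting_hyperplane_le) auto
  obtain A where A: "A \<subseteq> T" "?F = convex hull A"
    using face_of_convex_hull_subset[OF finite_imp_compact[OF fin] face] by blast
  have "A \<subseteq> {u, v}"
    using A eq hull_subset[of A convex] by blast
  then have "?F \<subseteq> closed_segment u v"
    unfolding A segment_convex_hull by (rule hull_mono)
  moreover have "closed_segment u v \<subseteq> ?F"
    using on uv by (intro closed_segment_subset face_of_imp_convex[OF face]) (auto simp: hull_inc)
  ultimately have "closed_segment u v face_of (convex hull T)"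
    using face by simp
  moreover have "aff_dim (closed_segment u v) = 1"
    using uv by (simp add: segment_convex_hull aff_dim_convex_hull)
  ultimately show ?thesis
    by (simp add: edge_of_def)
qed

text \<open>
A face contains both ends of every segment of the hull whose relative interior it meets. The end \<open>y\<close> is on the
sphere and differs from \<open>u\<close> and \<open>v\<close>, so it is off the segment from \<open>u\<close> to \<open>v\<close>.
\<close>
lemma crossed_segment_not_edge_of:
  fixes T :: "'a::euclidean_space set"
  assumes T: "T \<subseteq> sphere c \<rho>" and uv: "u \<in> T" "v \<in> T"
    and xy: "x \<in> T" "y \<in> T - {u, v}"
    and p: "p \<in> closed_segment u v" "p \<in> closed_segment x y" "p \<noteq> x"
  shows "\<not> closed_segment u v edge_of (convex hull T)"
proof
  assume "closed_segment u v edge_of (convex hull T)"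
  then have face: "closed_segment u v face_of (convex hull T)"
    by (simp add: edge_of_def)
  have out: "y \<notin> closed_segment u v"
    using sphere_Int_closed_segment[OF subsetD[OF T] subsetD[OF T] subsetD[OF T], of u v y] uv xy by auto
  then have "p \<in> open_segment x y"
    using p by (auto simp: open_segment_def)
  then show False
    using face_ofD[OF face _ _ _ p(1)] xy out by (simp add: hull_inc)
qed

section \<open>Point sets whose points all see the same distances\<close>

text \<open>
The multiset \<open>M\<close> holds the squared distances from any point to the others, and \<open>\<delta>\<close> bounds it from below. The last
assumption is the crossing condition that rules out the pairs not at squared distance \<open>\<delta>\<close> as edges. It is
stated with closed segments and \<open>p \<noteq> x\<close> because membership in a closed segment is an equation between distances;
moreover \<open>p \<noteq> y\<close> follows, since \<open>y\<close> is on the sphere and cannot lie between \<open>u\<close> and \<open>v\<close>.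
\<close>
locale sphere_configuration =
  fixes T :: "(real^3) set" and c :: "real^3" and \<rho> :: real
    and M :: "real multiset" and \<delta> :: real
  assumes finite_points: "finite T"
    and on_sphere: "T \<subseteq> sphere c \<rho>"
    and profile: "u \<in> T \<Longrightarrow> image_mset (\<lambda>v. (dist u v)\<^sup>2) (mset_set (T - {u})) = M"
    and least: "d \<in># M \<Longrightarrow> \<delta> \<le> d"
    and crossed: "u \<in> T \<Longrightarrow> v \<in> T \<Longrightarrow> u \<noteq> v \<Longrightarrow> (dist u v)\<^sup>2 \<noteq> \<delta> \<Longrightarrow>
      \<exists>x\<in>T. \<exists>y\<in>T - {u, v}. \<exists>p\<in>closed_segment u v. p \<in> closed_segment x y \<and> p \<noteq> x"
begin

lemma vertices_hull: "vertices (convex hull T) = T"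
  unfolding vertices_def by (rule extreme_points_convex_hull_sphere[OF on_sphere])

lemma sq_dist_ge: 
  assumes "u \<in> T" "v \<in> T" "u \<noteq> v"
  shows "\<delta> \<le> (dist u v)\<^sup>2"
proof (rule least)
  show "(dist u v)\<^sup>2 \<in># M"
    unfolding profile[OF assms(1), symmetric] using assms finite_points by auto
qed

lemma edges_hull:
  "edges (convex hull T) = {closed_segment u v | u v. u \<in> T \<and> v \<in> T \<and> u \<noteq> v \<and> (dist u v)\<^sup>2 = \<delta>}"
    (is "_ = ?R")
proof (intro set_eqI iffI)
  fix e assume "e \<in> edges (convex hull T)"
  then have e: "e edge_of (convex hull T)"
    by (simp add: edges_def)
  then obtain u v where uv: "u \<in> T" "v \<in> T" "u \<noteq> v" "e = closed_segment u v"
    by (rule edge_of_convex_hull_sphereE[OF finite_points on_sphere])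
  have "(dist u v)\<^sup>2 = \<delta>"
    using crossed[OF uv(1-3)] crossed_segment_not_edge_of[OF on_sphere uv(1,2)] e uv(4) by blast
  then show "e \<in> ?R"
    using uv by blast
next
  fix e assume "e \<in> ?R"
  then obtain u v where uv: "u \<in> T" "v \<in> T" "u \<noteq> v" and e: "e = closed_segment u v" 
    and d: "(dist u v)\<^sup>2 = \<delta>" by blast
  have "dist u v \<le> dist x y" if "x \<in> T" "y \<in> T" "x \<noteq> y" for x y
    using sq_dist_ge[OF that] d by (metis power2_le_imp_le zero_le_dist)
  then show "e \<in> edges (convex hull T)"
    unfolding e edges_def using closest_pair_edge_of_convex_hull[OF finite_points on_sphere uv] by simp
qed

lemma vertex_in_segment:
  assumes "u \<in> T" "v \<in> T" "w \<in> T"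
  shows "w \<in> closed_segment u v \<longleftrightarrow> w \<in> {u, v}"
proof
  show "w \<in> {u, v}" if "w \<in> closed_segment u v"
    by (rule sphere_Int_closed_segment[of u c \<rho> v w]) (use assms on_sphere that in blast)+
  show "w \<in> closed_segment u v" if "w \<in> {u, v}"
    using that by fastforce
qed

lemma vertices_on_edge:
  assumes "e \<in> edges (convex hull T)"
  shows "card {v \<in> vertices (convex hull T). v \<in> e} = 2"
proof -
  obtain a b where ab: "a \<in> T" "b \<in> T" "a \<noteq> b" "e = closed_segment a b"
    using assms by (auto simp: edges_hull)
  have "{v \<in> T. v \<in> e} = {a, b}"
    using ab vertex_in_segment by auto
  then show ?thesis
    using ab by (simp add: vertices_hull)
qed

lemma edges_at_vertex:
  assumes "v \<in> vertices (convex hull T)"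
  shows "card {e \<in> edges (convex hull T). v \<in> e} = count M \<delta>"
proof -
  have v: "v \<in> T"
    using assms by (simp add: vertices_hull)
  have "{e \<in> edges (convex hull T). v \<in> e} = closed_segment v ` {w \<in> T - {v}. (dist v w)\<^sup>2 = \<delta>}"
  proof (intro equalityI subsetI)
    fix e assume "e \<in> {e \<in> edges (convex hull T). v \<in> e}"
    then obtain a b where ab: "a \<in> T" "b \<in> T" "a \<noteq> b" "(dist a b)\<^sup>2 = \<delta>" 
      and e: "e = closed_segment a b" "v \<in> closed_segment a b"
      by (auto simp: edges_hull)
    have "v = a \<or> v = b"
      using vertex_in_segment[of a b v] ab e v by auto
    then show "e \<in> closed_segment v ` {w \<in> T - {v}. (dist v w)\<^sup>2 = \<delta>}"
      using ab e by (auto simp: dist_commute closed_segment_commute)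
  qed (use v in \<open>auto simp: edges_hull\<close>)
  moreover have "inj_on (closed_segment v) A" for A
    by (auto simp: inj_on_def doubleton_eq_iff)
  ultimately have "card {e \<in> edges (convex hull T). v \<in> e} = card {w \<in> T - {v}. (dist v w)\<^sup>2 = \<delta>}"
    by (simp add: card_image)
  also have "\<dots> = count M \<delta>"
    unfolding profile[OF v, symmetric] using finite_points
    by (subst count_image_mset) (auto simp: vimage_def intro!: arg_cong[of _ _ card])
  finally show ?thesis .
qed

lemma finite_edges: "finite (edges (convex hull T))"
proof (rule finite_subset)
  show "edges (convex hull T) \<subseteq> (\<lambda>(u, v). closed_segment u v) ` (T \<times> T)"
    by (auto simp: edges_hull)
qed (simp add: finite_points)

lemma handshake: "2 * card (edges (convex hull T)) = card T * count M \<delta>"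
proof -
  have "(\<Sum>v\<in>vertices (convex hull T). card {e \<in> edges (convex hull T). v \<in> e})
      = 2 * card (edges (convex hull T))"
    using finite_points vertices_on_edge by (intro sum_multicount finite_edges) (auto simp: vertices_hull)
  then show ?thesis
    using edges_at_vertex by (simp add: vertices_hull)
qed

text \<open>
Each chord arises from two ordered pairs of points, so the product over ordered pairs of squared distances is the
square of the product over chords; grouped by first components it is a power of \<open>\<Prod>M\<close>.
\<close>
lemma chord_product:
  "(\<Prod>s\<in>chords (convex hull T). (chord_length s)\<^sup>2)\<^sup>2 = prod_mset M ^ card T"
proof -
  let ?X = "Sigma T (\<lambda>u. T - {u})"
  let ?g = "\<lambda>(u, v). closed_segment u v" and ?h = "\<lambda>(u, v). (dist u v)\<^sup>2"
  have finX: "finite ?X"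
    using finite_points by simp
  have chords: "chords (convex hull T) = ?g ` ?X"
    by (auto simp: chords_def vertices_hull image_iff)
  have fibre: "prod ?h {z \<in> ?X. ?g z = s} = ((chord_length s)\<^sup>2)\<^sup>2" if s: "s \<in> ?g ` ?X" for s
  proof -
    obtain u v where uv: "u \<in> T" "v \<in> T" "u \<noteq> v" "s = closed_segment u v"
      using s by auto
    have "{z \<in> ?X. ?g z = s} = {(u, v), (v, u)}"
      unfolding uv(4) using uv(1-3) by (auto simp: doubleton_eq_iff closed_segment_commute[of v u])
    then show ?thesis
      using uv by (simp add: chord_length_def diameter_closed_segment dist_commute power2_eq_square)
  qed
  have "(\<Prod>u\<in>T. \<Prod>v\<in>T - {u}. (dist u v)\<^sup>2) = prod ?h ?X"
    using finite_points by (subst prod.Sigma) auto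
  also have "\<dots> = (\<Prod>s\<in>?g ` ?X. prod ?h {z \<in> ?X. ?g z = s})"
    by (rule prod.image_gen[OF finX])
  also have "\<dots> = (\<Prod>s\<in>?g ` ?X. (chord_length s)\<^sup>2)\<^sup>2"
    using fibre by (simp add: prod_power_distrib cong: prod.cong)
  finally have "(\<Prod>s\<in>chords (convex hull T). (chord_length s)\<^sup>2)\<^sup>2 = (\<Prod>u\<in>T. \<Prod>v\<in>T - {u}. (dist u v)\<^sup>2)"
    by (simp add: chords)
  also have "\<dots> = (\<Prod>u\<in>T. prod_mset M)"
    using profile by (intro prod.cong refl) (simp add: prod_unfold_prod_mset)
  finally show ?thesis
    by simp
qed

text \<open>
The crossing condition survives because \<open>p\<close> lies between \<open>u\<close> and \<open>v\<close> iff
\<open>dist u v = dist u p + dist p v\<close>.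
\<close>
lemma similar_image:
  assumes r: "0 < r" and f: "\<forall>x y. dist (f x) (f y) = r * dist x y"
  shows "sphere_configuration (f ` T) (f c) (r * \<rho>) (image_mset ((*) (r\<^sup>2)) M) (r\<^sup>2 * \<delta>)"
proof
  have inj: "inj f"
    using r f by (metis dist_eq_0_iff injI less_irrefl mult_eq_0_iff)
  show "finite (f ` T)"
    using finite_points by simp
  show "f ` T \<subseteq> sphere (f c) (r * \<rho>)"
    using on_sphere f by auto
  show "image_mset (\<lambda>v. (dist u v)\<^sup>2) (mset_set (f ` T - {u})) = image_mset ((*) (r\<^sup>2)) M"
    if "u \<in> f ` T" for u
  proof -
    obtain w where w: "w \<in> T" "u = f w"
      using \<open>u \<in> f ` T\<close> by blast
    have "mset_set (f ` T - {u}) = image_mset f (mset_set (T - {w}))"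
      using inj by (subst image_mset_mset_set) 
        (auto simp: w inj_image_mem_iff image_set_diff intro: inj_on_subset)
    then show ?thesis
      using w f by (simp add: profile[OF w(1), symmetric] multiset.map_comp o_def power_mult_distrib)
  qed
  show "r\<^sup>2 * \<delta> \<le> d" if "d \<in># image_mset ((*) (r\<^sup>2)) M" for d
    using that least by (auto intro!: mult_left_mono)
  show "\<exists>x\<in>f ` T. \<exists>y\<in>f ` T - {u, v}. \<exists>p\<in>closed_segment u v. p \<in> closed_segment x y \<and> p \<noteq> x"
    if uv: "u \<in> f ` T" "v \<in> f ` T" "u \<noteq> v" "(dist u v)\<^sup>2 \<noteq> r\<^sup>2 * \<delta>" for u v
  proof -
    obtain a b where ab: "a \<in> T" "b \<in> T" "u = f a" "v = f b"
      using uv by blast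
    moreover have "(dist a b)\<^sup>2 \<noteq> \<delta>"
      using uv ab f by (auto simp: power_mult_distrib)
    ultimately obtain x y p where xyp: "x \<in> T" "y \<in> T - {a, b}" "p \<in> closed_segment a b"
        "p \<in> closed_segment x y" "p \<noteq> x"
      using crossed[of a b] uv by blast
    have seg: "f q \<in> closed_segment (f s) (f t)" if "q \<in> closed_segment s t" for q s t
      using that f by (simp add: between_mem_segment[symmetric] between distrib_left)
    show ?thesis
      using xyp ab inj seg by (intro bexI[of _ "f x"] bexI[of _ "f y"] bexI[of _ "f p"]) (auto dest: injD)
  qed
qed

end

section \<open>The scaling factor\<close>

text \<open>
The centre \<open>x\<close> of the unit sphere is the image of some \<open>y\<close>, which is at distance \<open>1 / r\<close> from all of \<open>S\<close>. As \<open>S\<close> also lies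
on a sphere around \<open>0\<close>, all points of \<open>S\<close> have the same inner product with \<open>y\<close>. The last hypothesis, which says that \<open>S\<close> is
not contained in a hyperplane, then forces \<open>y = 0\<close>.
\<close>
lemma similarity_circumradius:
  fixes f :: "'a::euclidean_space \<Rightarrow> 'a"
  assumes r: "0 < r" and f: "\<forall>x y. dist (f x) (f y) = r * dist x y"
    and S: "S \<subseteq> sphere 0 \<rho>" "S \<noteq> {}" "0 \<le> \<rho>" and unit: "f ` S \<subseteq> sphere x 1"
    and spanning: "\<And>y. (\<And>u v. u \<in> S \<Longrightarrow> v \<in> S \<Longrightarrow> u \<bullet> y = v \<bullet> y) \<Longrightarrow> y = 0"
  shows "r\<^sup>2 * \<rho>\<^sup>2 = 1"
proof -
  let ?g = "\<lambda>z. (1 / r) *\<^sub>R (f z - f 0)"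
  have "orthogonal_transformation ?g"
    using r f by (simp add: orthogonal_transformation_isometry dist_norm flip: scaleR_diff_right)
  then have "surj ?g"
    by (rule orthogonal_transformation_surj)
  then obtain y where "(1 / r) *\<^sub>R (x - f 0) = ?g y"
    by (rule surjE)
  then have y: "f y = x"
    using r by simp
  have ry: "r\<^sup>2 * (dist y u)\<^sup>2 = 1" if "u \<in> S" for u
  proof -
    have "r * dist y u = 1"
      using unit that y f by force
    then show ?thesis
      by (metis power_mult_distrib one_power2)
  qed
  have norm: "u \<bullet> u = \<rho>\<^sup>2" if "u \<in> S" for u
    using S that by (auto simp: dot_square_norm)
  have "u \<bullet> y = v \<bullet> y" if "u \<in> S" "v \<in> S" for u v
  proof -
    have "(dist y u)\<^sup>2 = (dist y v)\<^sup>2"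
      using ry[OF that(1)] ry[OF that(2)] r by (metis mult_left_cancel zero_less_power less_irrefl)
    then show ?thesis
      using norm that by (simp add: dist_norm power2_norm_eq_inner inner_diff inner_commute)
  qed
  then have "y = 0"
    by (rule spanning)
  then show ?thesis
    using ry S(1,2) by fastforce
qed

section \<open>Exact arithmetic with the golden ratio\<close>

lemma golden_ratio_sq: "golden_ratio * golden_ratio = golden_ratio + 1"
proof -
  have "sqrt 5 * sqrt 5 = (5::real)"
    by simp
  then show ?thesis
    by (simp add: golden_ratio_def field_simps)
qed

lemma golden_ratio_bounds: "1 < golden_ratio" "golden_ratio < 2"
proof -
  have "1 < sqrt (5::real)"
    by simp
  moreover have "sqrt 5 < (3::real)"
    by (rule real_less_lsqrt) auto
  ultimately show "1 < golden_ratio" "golden_ratio < 2"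
    by (simp_all add: golden_ratio_def)
qed

lemma inverse_golden_ratio: "1 / golden_ratio = golden_ratio - 1"
  using golden_ratio_sq golden_ratio_bounds by (simp add: field_simps)

text \<open>
The pair \<open>(a, b)\<close> of integers stands for \<open>a + b \<phi>\<close>. Unlike the real numbers, these pairs can be compared by
computation.
\<close>
type_synonym zphi = "int \<times> int"
type_synonym zpoint = "zphi \<times> zphi \<times> zphi"

fun zadd :: "zphi \<Rightarrow> zphi \<Rightarrow> zphi" where
  "zadd (a, b) (c, d) = (a + c, b + d)"

fun zsub :: "zphi \<Rightarrow> zphi \<Rightarrow> zphi" where
  "zsub (a, b) (c, d) = (a - c, b - d)"

fun zmul :: "zphi \<Rightarrow> zphi \<Rightarrow> zphi" where
  "zmul (a, b) (c, d) = (a * c + b * d, a * d + b * c + b * d)"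

definition zprod :: "zphi list \<Rightarrow> zphi" where
  "zprod ds = foldr zmul ds (1, 0)"

fun zval :: "zphi \<Rightarrow> real" where
  "zval (a, b) = of_int a + of_int b * golden_ratio"

fun zpoint_val :: "zpoint \<Rightarrow> real^3" where
  "zpoint_val (x, y, z) = vector [zval x, zval y, zval z]"

lemma zval_zadd: "zval (zadd p q) = zval p + zval q"
  by (cases p; cases q) (simp add: algebra_simps)

lemma zval_zsub: "zval (zsub p q) = zval p - zval q"
  by (cases p; cases q) (simp add: algebra_simps)

lemma zval_zmul: "zval (zmul p q) = zval p * zval q"
proof (cases p; cases q)
  fix a b c d
  assume p: "p = (a, b)" and q: "q = (c, d)"
  have "real_of_int b * golden_ratio * (real_of_int d * golden_ratio)
      = real_of_int b * real_of_int d * (golden_ratio + 1)"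
    unfolding golden_ratio_sq[symmetric] by (simp add: ac_simps)
  then show ?thesis
    by (simp add: p q algebra_simps)
qed

lemma zval_zprod: "zval (zprod ds) = prod_list (map zval ds)"
  unfolding zprod_def by (induction ds) (simp_all add: zval_zmul)

fun zsq_dist :: "zpoint \<Rightarrow> zpoint \<Rightarrow> zphi" where
  "zsq_dist (x, y, z) (x', y', z') =
    zadd (zmul (zsub x x') (zsub x x'))
      (zadd (zmul (zsub y y') (zsub y y')) (zmul (zsub z z') (zsub z z')))"

lemma zval_zsq_dist: "zval (zsq_dist u v) = (dist (zpoint_val u) (zpoint_val v))\<^sup>2"
  by (cases u rule: zpoint_val.cases; cases v rule: zpoint_val.cases)
    (simp add: zval_zadd zval_zsub zval_zmul dist_vec_def L2_set_def sum_3 vector_3 dist_real_def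
      power2_eq_square)

fun zcomb :: "zphi \<times> zphi \<times> zphi \<Rightarrow> zphi \<Rightarrow> zphi \<Rightarrow> zphi \<Rightarrow> zphi" where
  "zcomb (\<alpha>, \<beta>, \<gamma>) u v x = zsub (zadd (zmul \<alpha> u) (zmul \<beta> v)) (zmul \<gamma> x)"

text \<open>
The point \<open>y\<close> with \<open>\<alpha> u + \<beta> v = \<gamma> x + y\<close>. If the weights are nonnegative and \<open>\<alpha> + \<beta> = \<gamma> + 1\<close>, then after division by
\<open>\<gamma> + 1\<close> this equation says that the segments from \<open>u\<close> to \<open>v\<close> and from \<open>x\<close> to \<open>y\<close> meet.
\<close>
fun zfourth :: "zphi \<times> zphi \<times> zphi \<Rightarrow> zpoint \<Rightarrow> zpoint \<Rightarrow> zpoint \<Rightarrow> zpoint" where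
  "zfourth w (u1, u2, u3) (v1, v2, v3) (x1, x2, x3) =
    (zcomb w u1 v1 x1, zcomb w u2 v2 x2, zcomb w u3 v3 x3)"

lemma zpoint_val_zfourth:
  "zpoint_val (zfourth (\<alpha>, \<beta>, \<gamma>) u v x) =
    zval \<alpha> *\<^sub>R zpoint_val u + zval \<beta> *\<^sub>R zpoint_val v - zval \<gamma> *\<^sub>R zpoint_val x"
  by (cases u rule: zpoint_val.cases; cases v rule: zpoint_val.cases; cases x rule: zpoint_val.cases)
    (simp add: zval_zadd zval_zsub zval_zmul vec_eq_iff forall_3 vector_3)

text \<open>
Three ways in which a segment meets another suffice for all five solids. Weights \<open>(1, 1, 1)\<close>: the diagonals
of a parallelogram, which covers antipodal points and the diagonals of squares. Weights \<open>(1, \<phi>, \<phi>)\<close>: two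
diagonals of a regular pentagon, which cut each other in the golden ratio. Weights \<open>(2, \<phi> - 1, \<phi>)\<close>: the pairs of
dodecahedron vertices at distance \<open>2 \<phi>\<close>, for example \<open>(0, 1/\<phi>, \<phi>)\<close> and \<open>(0, 1/\<phi>, -\<phi>)\<close>, whose segment meets
the one from \<open>(1, 1, 1)\<close> to \<open>(-\<phi>, 0, 1/\<phi>)\<close>.
\<close>
definition crossing_weights :: "(zphi \<times> zphi \<times> zphi) list" where
  "crossing_weights =
    [((1, 0), (1, 0), (1, 0)), ((1, 0), (0, 1), (0, 1)), ((2, 0), (-1, 1), (0, 1))]"

definition zcrossed :: "zpoint list \<Rightarrow> zpoint \<Rightarrow> zpoint \<Rightarrow> bool" where
  "zcrossed L u v \<longleftrightarrow>
    (\<exists>w\<in>set crossing_weights. \<exists>x\<in>set L. let y = zfourth w u v x in y \<notin> set [u, v, x] \<and> y \<in> set L)"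

text \<open>
The computable form of the hypotheses on a point set. The list \<open>ds\<close> gives the squared distances from any point to the others,
with that of the pairs exempt from crossing at its head; \<open>R\<close> is the squared circumradius.
\<close>
definition zregular :: "zpoint list \<Rightarrow> zphi \<Rightarrow> zphi list \<Rightarrow> bool" where
  "zregular L R ds \<longleftrightarrow> distinct L \<and>
    (\<forall>u\<in>set L. zsq_dist ((0, 0), (0, 0), (0, 0)) u = R \<and>
      mset (map (zsq_dist u) (remove1 u L)) = mset ds \<and>
      (\<forall>v\<in>set L. v = u \<or> zsq_dist u v = hd ds \<or> zcrossed L u v))"

lemma weighted_crossing:
  fixes u v x y :: "'a::real_vector"
  assumes pos: "0 \<le> \<alpha>" "0 \<le> \<beta>" "0 \<le> \<gamma>" and sum: "\<alpha> + \<beta> = \<gamma> + (1::real)"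
    and eq: "\<alpha> *\<^sub>R u + \<beta> *\<^sub>R v = \<gamma> *\<^sub>R x + y" and "x \<noteq> y"
  shows "\<exists>p\<in>closed_segment u v. p \<in> closed_segment x y \<and> p \<noteq> x"
proof -
  define p where "p = (1 / (\<gamma> + 1)) *\<^sub>R (\<gamma> *\<^sub>R x + y)"
  have "p = (1 / (\<alpha> + \<beta>)) *\<^sub>R (\<alpha> *\<^sub>R u + \<beta> *\<^sub>R v)"
    by (simp add: p_def sum eq)
  moreover have "1 - \<beta> / (\<alpha> + \<beta>) = \<alpha> / (\<alpha> + \<beta>)"
    using pos sum by (simp add: field_simps)
  ultimately have uv: "p = (1 - \<beta> / (\<alpha> + \<beta>)) *\<^sub>R u + (\<beta> / (\<alpha> + \<beta>)) *\<^sub>R v"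
    by (simp add: scaleR_add_right)
  have "1 - 1 / (\<gamma> + 1) = \<gamma> / (\<gamma> + 1)"
    using pos by (simp add: field_simps)
  then have xy: "p = (1 - 1 / (\<gamma> + 1)) *\<^sub>R x + (1 / (\<gamma> + 1)) *\<^sub>R y"
    by (simp add: p_def scaleR_add_right)
  have "p - x = (1 / (\<gamma> + 1)) *\<^sub>R (y - x)"
    unfolding xy by (simp add: algebra_simps)
  then have "p \<noteq> x"
    using pos \<open>x \<noteq> y\<close> by auto
  moreover have "p \<in> closed_segment u v"
    unfolding in_segment using pos sum by (intro exI[of _ "\<beta> / (\<alpha> + \<beta>)"]) (simp add: uv)
  moreover have "p \<in> closed_segment x y"
    unfolding in_segment using pos by (intro exI[of _ "1 / (\<gamma> + 1)"]) (simp add: xy)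
  ultimately show ?thesis
    by blast
qed

text \<open>
The map from coordinate lists to points is injective on \<open>L\<close> because the squared distances of distinct entries
evaluate to positive numbers.
\<close>
lemma
  assumes reg: "zregular L R ds" and pos: "0 < zval (hd ds)"
    and least: "\<forall>d\<in>set ds. d = hd ds \<or> zval (hd ds) < zval d"
  shows sphere_configuration_zpoints:
      "sphere_configuration (zpoint_val ` set L) 0 (sqrt (zval R))
        (image_mset zval (mset ds)) (zval (hd ds))"
    and card_zpoints: "card (zpoint_val ` set L) = length L"
proof -
  have dist: "distinct L"
    and norm: "\<And>u. u \<in> set L \<Longrightarrow> zsq_dist ((0, 0), (0, 0), (0, 0)) u = R"
    and prof: "\<And>u. u \<in> set L \<Longrightarrow> mset (map (zsq_dist u) (remove1 u L)) = mset ds"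
    and cross: "\<And>u v. u \<in> set L \<Longrightarrow> v \<in> set L \<Longrightarrow> v = u \<or> zsq_dist u v = hd ds \<or> zcrossed L u v"
    using reg by (auto simp: zregular_def)
  have inj: "inj_on zpoint_val (set L)"
  proof (rule inj_onI, rule ccontr)
    fix u v assume uv: "u \<in> set L" "v \<in> set L" "zpoint_val u = zpoint_val v" "u \<noteq> v"
    then have "zsq_dist u v \<in> set (map (zsq_dist u) (remove1 u L))"
      by simp
    then have "zsq_dist u v \<in> set ds"
      using prof[OF uv(1)] by (metis set_mset_mset)
    then have "0 < zval (zsq_dist u v)"
      using least pos by force
    then show False
      using uv by (simp add: zval_zsq_dist)
  qed
  then show "card (zpoint_val ` set L) = length L"
    using dist by (simp add: card_image distinct_card)
  have zero: "zpoint_val ((0, 0), (0, 0), (0, 0)) = 0"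
    by (simp add: vec_eq_iff forall_3 vector_3)
  show "sphere_configuration (zpoint_val ` set L) 0 (sqrt (zval R))
      (image_mset zval (mset ds)) (zval (hd ds))"
  proof
    show "finite (zpoint_val ` set L)"
      by simp
    show "zpoint_val ` set L \<subseteq> sphere 0 (sqrt (zval R))"
    proof clarify
      fix u assume "u \<in> set L"
      then have "(dist 0 (zpoint_val u))\<^sup>2 = zval R"
        using zval_zsq_dist[of "((0, 0), (0, 0), (0, 0))" u] norm zero by simp
      then show "zpoint_val u \<in> sphere 0 (sqrt (zval R))"
        by (metis mem_sphere real_sqrt_unique zero_le_dist)
    qed
    show "image_mset (\<lambda>v. (dist u v)\<^sup>2) (mset_set (zpoint_val ` set L - {u})) = image_mset zval (mset ds)"
      if "u \<in> zpoint_val ` set L" for u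
    proof -
      obtain w where w: "w \<in> set L" "u = zpoint_val w"
        using \<open>u \<in> zpoint_val ` set L\<close> by blast
      have "zpoint_val ` set L - {u} = zpoint_val ` set (remove1 w L)"
        using w dist inj_on_image_set_diff[OF inj, of "set L" "{w}"] by simp
      moreover have "inj_on zpoint_val (set (remove1 w L))"
        using inj by (rule inj_on_subset) (rule set_remove1_subset)
      ultimately have "mset_set (zpoint_val ` set L - {u}) = image_mset zpoint_val (mset (remove1 w L))"
        using dist by (metis distinct_remove1 image_mset_mset_set mset_set_set)
      moreover have "mset ds = image_mset (zsq_dist w) (mset (remove1 w L))"
        using prof[OF w(1)] by simp
      ultimately show ?thesis
        by (simp add: w multiset.map_comp o_def zval_zsq_dist)
    qed
    show "zval (hd ds) \<le> d" if "d \<in># image_mset zval (mset ds)" for d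
    proof -
      obtain d' where d': "d' \<in> set ds" "d = zval d'"
        using \<open>d \<in># image_mset zval (mset ds)\<close> unfolding set_image_mset set_mset_mset by blast
      have "d' = hd ds \<or> zval (hd ds) < zval d'"
        using least d'(1) by (rule bspec)
      then show ?thesis
        unfolding d'(2) by (elim disjE) simp_all
    qed
    show "\<exists>x\<in>zpoint_val ` set L. \<exists>y\<in>zpoint_val ` set L - {u, v}.
        \<exists>p\<in>closed_segment u v. p \<in> closed_segment x y \<and> p \<noteq> x"
      if uv: "u \<in> zpoint_val ` set L" "v \<in> zpoint_val ` set L" "u \<noteq> v" "(dist u v)\<^sup>2 \<noteq> zval (hd ds)" for u v
    proof -
      obtain a b where ab: "a \<in> set L" "b \<in> set L" "u = zpoint_val a" "v = zpoint_val b"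
        using uv by blast
      moreover have "zsq_dist a b \<noteq> hd ds"
        using uv(4) unfolding ab(3,4) zval_zsq_dist[symmetric] by metis
      ultimately have "zcrossed L a b"
        using cross[OF ab(1,2)] uv(3) by blast
      then obtain w x y where w: "w \<in> set crossing_weights" and x: "x \<in> set L"
        and y: "y = zfourth w a b x" "y \<notin> set [a, b, x]" "y \<in> set L"
        unfolding zcrossed_def Let_def by blast
      obtain \<alpha> \<beta> \<gamma> where weights: "w = (\<alpha>, \<beta>, \<gamma>)"
        by (cases w)
      have pos: "0 \<le> zval \<alpha>" "0 \<le> zval \<beta>" "0 \<le> zval \<gamma>"
        and sum: "zval \<alpha> + zval \<beta> = zval \<gamma> + 1"
        using w golden_ratio_bounds by (auto simp: crossing_weights_def weights)
      have eq: "zval \<alpha> *\<^sub>R u + zval \<beta> *\<^sub>R v = zval \<gamma> *\<^sub>R zpoint_val x + zpoint_val y"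
        by (simp add: y(1) weights zpoint_val_zfourth ab)
      have "zpoint_val x \<noteq> zpoint_val y"
        using inj_on_eq_iff[OF inj x y(3)] y(2) by auto
      then have "\<exists>p\<in>closed_segment u v. p \<in> closed_segment (zpoint_val x) (zpoint_val y) \<and> p \<noteq> zpoint_val x"
        by (rule weighted_crossing[OF pos sum eq])
      moreover have "zpoint_val y \<in> zpoint_val ` set L - {u, v}"
        using inj_on_eq_iff[OF inj y(3) ab(1)] inj_on_eq_iff[OF inj y(3) ab(2)] y(2,3)
        by (simp add: ab(3,4))
      ultimately show ?thesis
        using x by blast
    qed
  qed
qed

section \<open>From coordinates to the product of the chords\<close>

definition chord_data :: "(real^3) set \<Rightarrow> nat \<Rightarrow> nat \<Rightarrow> real \<Rightarrow> bool" where
  "chord_data P V \<epsilon> C \<longleftrightarrow>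
    (\<forall>e\<in>edges P. card {v \<in> vertices P. v \<in> e} = 2) \<and>
    (\<forall>v\<in>vertices P. card {e \<in> edges P. v \<in> e} = \<epsilon>) \<and>
    card (vertices P) = V \<and> 2 * card (edges P) = V * \<epsilon> \<and>
    (\<Prod>c\<in>chords P. (chord_length c)\<^sup>2) = C"

text \<open>
On the unit sphere the squared distances are those of \<open>ds\<close> divided by \<open>R\<close>. The equation between \<open>p\<close> and \<open>q\<close> says,
cleared of denominators, that their product is \<open>p / q\<close>. With \<open>2 k\<close> vertices the square of the product over
chords is then \<open>(p / q)^(2 k)\<close>, and a square root gives \<open>(p / q)^k\<close>.
\<close>
lemma chord_data_zpoints:
  assumes reg: "zregular L R ds" and pos: "0 < zval (hd ds)"
    and least: "\<forall>d\<in>set ds. d = hd ds \<or> zval (hd ds) < zval d"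
    and prod: "zmul (zprod ds) (q, 0) = zmul (zprod (map (\<lambda>_. R) ds)) (p, 0)"
    and pq: "0 < p" "0 < q" and Rpos: "0 < zval R" 
    and even: "length L = 2 * k" "0 < k"
    and spanning: "\<And>y. (\<And>u v. u \<in> zpoint_val ` set L \<Longrightarrow> v \<in> zpoint_val ` set L \<Longrightarrow> u \<bullet> y = v \<bullet> y) \<Longrightarrow> y = 0"
    and sim: "similar P (convex hull (zpoint_val ` set L))"
    and inscribed: "inscribed_in_unit_sphere P"
  shows "chord_data P (2 * k) (count_list ds (hd ds)) ((of_int p / of_int q) ^ k)"
proof -
  let ?S = "zpoint_val ` set L"
  obtain f r where r: "0 < r" and f: "\<forall>x y. dist (f x) (f y) = r * dist x y"
    and "P = f ` (convex hull ?S)"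
    using sim by (auto simp: similar_def)
  then have P: "P = convex hull (f ` ?S)"
    by (simp add: similarity_image_convex_hull[OF f])
  interpret S: sphere_configuration ?S 0 "sqrt (zval R)" "image_mset zval (mset ds)" "zval (hd ds)"
    by (rule sphere_configuration_zpoints[OF reg pos least])
  let ?M = "image_mset ((*) (r\<^sup>2)) (image_mset zval (mset ds))"
  interpret T: sphere_configuration "f ` ?S" "f 0" "r * sqrt (zval R)" ?M "r\<^sup>2 * zval (hd ds)"
    by (rule S.similar_image[OF r f])
  have "inj f"
    using r f by (metis dist_eq_0_iff injI less_irrefl mult_eq_0_iff)
  then have card: "card (f ` ?S) = 2 * k"
    using card_zpoints[OF reg pos least] even by (simp add: card_image inj_on_subset)
  obtain x where "vertices P \<subseteq> sphere x 1"
    using inscribed by (auto simp: inscribed_in_unit_sphere_def)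
  then have unit: "f ` ?S \<subseteq> sphere x 1"
    by (simp add: P T.vertices_hull)
  have "?S \<noteq> {}" "0 \<le> sqrt (zval R)"
    using even Rpos by force+
  then have "r\<^sup>2 * (sqrt (zval R))\<^sup>2 = 1"
    by (rule similarity_circumradius[OF r f S.on_sphere _ _ unit spanning])
  then have rR: "r\<^sup>2 * zval R = 1"
    using Rpos by simp
  have M: "?M = mset (map (\<lambda>d. r\<^sup>2 * zval d) ds)"
    by (simp add: multiset.map_comp comp_def)
  have scaled: "prod_list (map (\<lambda>d. r\<^sup>2 * zval d) xs) = (r\<^sup>2) ^ length xs * prod_list (map zval xs)" for xs
    by (induction xs) (simp_all add: ac_simps)
  have const: "zval (zprod (map (\<lambda>_. R) ds)) = zval R ^ length ds"
    by (simp add: zval_zprod comp_def map_replicate_const prod_list_replicate)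
  have "prod_mset ?M * of_int q = (r\<^sup>2) ^ length ds * zval (zmul (zprod ds) (q, 0))"
    unfolding M prod_mset_prod_list scaled by (simp add: zval_zmul zval_zprod)
  also have "\<dots> = (r\<^sup>2 * zval R) ^ length ds * of_int p"
    by (simp add: prod zval_zmul const power_mult_distrib)
  finally have "prod_mset ?M * of_int q = of_int p"
    by (simp only: rR power_one mult_1_left)
  then have prod_M: "prod_mset ?M = of_int p / of_int q"
    using pq by (simp add: eq_divide_eq)
  let ?C = "\<Prod>c\<in>chords P. (chord_length c)\<^sup>2"
  have "?C\<^sup>2 = ((of_int p / of_int q) ^ k)\<^sup>2"
    by (simp add: P T.chord_product card prod_M mult.commute flip: power_mult)
  moreover have "0 \<le> ?C"
    by (rule prod_nonneg) simp
  moreover have "0 \<le> (of_int p / of_int q :: real) ^ k"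
    using pq by simp
  ultimately have C: "?C = (of_int p / of_int q) ^ k"
    by (rule power2_eq_imp_eq)
  have "count ?M (r\<^sup>2 * zval (hd ds)) = length (filter (\<lambda>d. r\<^sup>2 * zval (hd ds) = r\<^sup>2 * zval d) ds)"
    unfolding M count_mset count_list_eq_length_filter filter_map length_map comp_def ..
  also have "\<dots> = length (filter ((=) (hd ds)) ds)"
  proof (intro arg_cong[of _ _ length] filter_cong refl)
    fix d assume "d \<in> set ds"
    with least have "d = hd ds \<or> zval (hd ds) < zval d"
      by (rule bspec)
    then have "zval (hd ds) = zval d \<longleftrightarrow> hd ds = d"
      by (metis less_irrefl)
    then show "r\<^sup>2 * zval (hd ds) = r\<^sup>2 * zval d \<longleftrightarrow> hd ds = d"
      using r by simp
  qed
  finally have deg: "count ?M (r\<^sup>2 * zval (hd ds)) = count_list ds (hd ds)"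
    by (simp add: count_list_eq_length_filter)
  show ?thesis
    unfolding chord_data_def
  proof (intro conjI ballI)
    show "card {v \<in> vertices P. v \<in> e} = 2" if "e \<in> edges P" for e
      using that unfolding P by (rule T.vertices_on_edge)
    show "card {e \<in> edges P. v \<in> e} = count_list ds (hd ds)" if "v \<in> vertices P" for v
      using that unfolding P deg[symmetric] by (rule T.edges_at_vertex)
    show "card (vertices P) = 2 * k"
      unfolding P T.vertices_hull by (rule card)
    show "2 * card (edges P) = 2 * k * count_list ds (hd ds)"
      unfolding P T.handshake card deg ..
  qed (rule C)
qed

section \<open>The five solids\<close>

definition zcyclic :: "zphi \<Rightarrow> zphi \<Rightarrow> zphi \<Rightarrow> zpoint list" where
  "zcyclic x y z = [(x, y, z), (y, z, x), (z, x, y)]"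

definition ztetrahedron :: "zpoint list" where
  "ztetrahedron = ((1, 0), (1, 0), (1, 0)) # zcyclic (1, 0) (-1, 0) (-1, 0)"

definition zoctahedron :: "zpoint list" where
  "zoctahedron = concat (map (\<lambda>s. zcyclic (s, 0) (0, 0) (0, 0)) [-1, 1])"

definition zcube :: "zpoint list" where
  "zcube = concat (map (\<lambda>s. concat (map (\<lambda>t. map (\<lambda>u. ((s, 0), (t, 0), (u, 0))) [-1, 1]) [-1, 1])) [-1, 1])"

definition zicosahedron :: "zpoint list" where
  "zicosahedron = concat (map (\<lambda>s. concat (map (\<lambda>t. zcyclic (0, 0) (s, 0) (0, t)) [-1, 1])) [-1, 1])"

definition zdodecahedron :: "zpoint list" where
  "zdodecahedron = zcube @
    concat (map (\<lambda>s. concat (map (\<lambda>t. zcyclic (0, 0) (-s, s) (0, t)) [-1, 1])) [-1, 1])"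

lemma zpoint_val_zcyclic:
  "zpoint_val ` set (zcyclic x y z) = cyclic_permutations (zval x) (zval y) (zval z)"
  by (simp add: zcyclic_def cyclic_permutations_def)

lemma tetrahedron_points:
  "zpoint_val ` set ztetrahedron = insert (vector [1, 1, 1]) (cyclic_permutations 1 (-1) (-1))"
  by (simp add: ztetrahedron_def zpoint_val_zcyclic)

lemma octahedron_points:
  "zpoint_val ` set zoctahedron = (\<Union>s\<in>{-1, 1}. cyclic_permutations s 0 0)"
  by (simp add: zoctahedron_def zpoint_val_zcyclic image_Un)

lemma cube_points: "zpoint_val ` set zcube = cube_vertices"
proof -
  have "cube_vertices = (\<Union>s\<in>{-1, 1}. \<Union>t\<in>{-1, 1}. \<Union>u\<in>{-1, 1}. {vector [s, t, u]})"
    unfolding cube_vertices_def by blast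
  then show ?thesis
    by (simp add: zcube_def insert_commute)
qed

lemma icosahedron_points:
  "zpoint_val ` set zicosahedron =
    (\<Union>s\<in>{-1, 1}. \<Union>t\<in>{-1, 1}. cyclic_permutations 0 s (t * golden_ratio))"
  by (simp add: zicosahedron_def zpoint_val_zcyclic image_Un Un_ac)

text \<open>
The coordinates \<open>\<plusminus>1/\<phi>\<close> are entered as \<open>(-s, s)\<close>, since \<open>1/\<phi> = \<phi> - 1\<close>.
\<close>
lemma dodecahedron_points:
  "zpoint_val ` set zdodecahedron = cube_vertices \<union>
    (\<Union>s\<in>{-1, 1}. \<Union>t\<in>{-1, 1}. cyclic_permutations 0 (s / golden_ratio) (t * golden_ratio))"
proof -
  have "-1 / golden_ratio = 1 - golden_ratio"
    using inverse_golden_ratio by (simp add: field_simps)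
  then show ?thesis
    by (simp add: zdodecahedron_def zpoint_val_zcyclic image_Un Un_ac cube_points inverse_golden_ratio)
qed

lemma inner_vector_3: "vector [a, b, c] \<bullet> (y :: real^3) = a * y$1 + b * y$2 + c * y$3"
  by (simp add: inner_vec_def sum_3 vector_3)

lemma zregular_tetrahedron: "zregular ztetrahedron (3, 0) (replicate 3 (8, 0))"
  by code_simp

lemma zregular_octahedron: "zregular zoctahedron (1, 0) (replicate 4 (2, 0) @ [(4, 0)])"
  by code_simp

lemma zregular_cube: "zregular zcube (3, 0) (replicate 3 (4, 0) @ replicate 3 (8, 0) @ [(12, 0)])"
  by code_simp

lemma zregular_icosahedron:
  "zregular zicosahedron (2, 1) (replicate 5 (4, 0) @ replicate 5 (4, 4) @ [(8, 4)])"
  by code_simp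

lemma zregular_dodecahedron:
  "zregular zdodecahedron (3, 0)
    (replicate 3 (8, -4) @ replicate 6 (4, 0) @ replicate 6 (8, 0) @ replicate 3 (4, 4) @ [(12, 0)])"
  by code_simp

text \<open>
In this lemma and its analogues for the other solids, the vertex pairs are chosen so that equality of their inner products with \<open>y\<close>
determines \<open>y\<close> to be \<open>0\<close>.
\<close>
lemma tetrahedron_chord_data:
  assumes "regular_tetrahedron P" "inscribed_in_unit_sphere P"
  shows "chord_data P 4 3 ((2 ^ 9 / 3 ^ 3) ^ 2)"
proof -
  let ?ds = "replicate 3 (8, 0) :: zphi list"
  have "chord_data P (2 * 2) (count_list ?ds (hd ?ds)) ((of_int (2 ^ 9) / of_int (3 ^ 3)) ^ 2)"
  proof (rule chord_data_zpoints[OF zregular_tetrahedron _ _ _ _ _ _ _ _ _ _ assms(2)])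
    show "zmul (zprod ?ds) (3 ^ 3, 0) = zmul (zprod (map (\<lambda>_. (3, 0)) ?ds)) (2 ^ 9, 0)"
      by code_simp
    show "length ztetrahedron = 2 * 2"
      by code_simp
    show "y = 0" if y: "\<And>u v. u \<in> zpoint_val ` set ztetrahedron \<Longrightarrow>
        v \<in> zpoint_val ` set ztetrahedron \<Longrightarrow> u \<bullet> y = v \<bullet> y" for y
      using y[of "vector [1, 1, 1]" "vector [1, -1, -1]"]
        y[of "vector [1, 1, 1]" "vector [-1, -1, 1]"]
        y[of "vector [1, 1, 1]" "vector [-1, 1, -1]"]
      by (simp add: tetrahedron_points cyclic_permutations_def inner_vector_3 vec_eq_iff forall_3)
    show "similar P (convex hull (zpoint_val ` set ztetrahedron))"
      using assms(1) by (simp add: regular_tetrahedron_def tetrahedron_points)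
  qed (use golden_ratio_bounds in simp_all)
  moreover have "count_list ?ds (hd ?ds) = 3"
    by code_simp
  ultimately show ?thesis
    by simp
qed

lemma octahedron_chord_data:
  assumes "regular_octahedron P" "inscribed_in_unit_sphere P"
  shows "chord_data P 6 4 ((2 ^ 6 / 1) ^ 3)"
proof -
  let ?ds = "replicate 4 (2, 0) @ [(4, 0)] :: zphi list"
  have "chord_data P (2 * 3) (count_list ?ds (hd ?ds)) ((of_int (2 ^ 6) / of_int (1)) ^ 3)"
  proof (rule chord_data_zpoints[OF zregular_octahedron _ _ _ _ _ _ _ _ _ _ assms(2)])
    show "zmul (zprod ?ds) (1, 0) = zmul (zprod (map (\<lambda>_. (1, 0)) ?ds)) (2 ^ 6, 0)"
      by code_simp
    show "length zoctahedron = 2 * 3"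
      by code_simp
    show "y = 0" if y: "\<And>u v. u \<in> zpoint_val ` set zoctahedron \<Longrightarrow>
        v \<in> zpoint_val ` set zoctahedron \<Longrightarrow> u \<bullet> y = v \<bullet> y" for y
      using y[of "vector [1, 0, 0]" "vector [-1, 0, 0]"]
        y[of "vector [0, 1, 0]" "vector [0, -1, 0]"]
        y[of "vector [0, 0, 1]" "vector [0, 0, -1]"]
      by (simp add: octahedron_points cyclic_permutations_def inner_vector_3 vec_eq_iff forall_3)
    show "similar P (convex hull (zpoint_val ` set zoctahedron))"
      using assms(1) by (simp add: regular_octahedron_def octahedron_points)
  qed (use golden_ratio_bounds in simp_all)
  moreover have "count_list ?ds (hd ?ds) = 4"
    by code_simp
  ultimately show ?thesis
    by simp
qed

lemma cube_chord_data:
  assumes "regular_cube P" "inscribed_in_unit_sphere P"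
  shows "chord_data P 8 3 ((2 ^ 17 / 3 ^ 6) ^ 4)"
proof -
  let ?ds = "replicate 3 (4, 0) @ replicate 3 (8, 0) @ [(12, 0)] :: zphi list"
  have "chord_data P (2 * 4) (count_list ?ds (hd ?ds)) ((of_int (2 ^ 17) / of_int (3 ^ 6)) ^ 4)"
  proof (rule chord_data_zpoints[OF zregular_cube _ _ _ _ _ _ _ _ _ _ assms(2)])
    show "zmul (zprod ?ds) (3 ^ 6, 0) = zmul (zprod (map (\<lambda>_. (3, 0)) ?ds)) (2 ^ 17, 0)"
      by code_simp
    show "length zcube = 2 * 4"
      by code_simp
    show "y = 0" if y: "\<And>u v. u \<in> zpoint_val ` set zcube \<Longrightarrow>
        v \<in> zpoint_val ` set zcube \<Longrightarrow> u \<bullet> y = v \<bullet> y" for y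
      using y[of "vector [1, 1, 1]" "vector [-1, 1, 1]"]
        y[of "vector [1, 1, 1]" "vector [1, -1, 1]"]
        y[of "vector [1, 1, 1]" "vector [1, 1, -1]"]
      by (simp add: cube_points cyclic_permutations_def cube_vertices_def inner_vector_3 vec_eq_iff forall_3)
    show "similar P (convex hull (zpoint_val ` set zcube))"
      using assms(1) by (simp add: regular_cube_def cube_points)
  qed (use golden_ratio_bounds in simp_all)
  moreover have "count_list ?ds (hd ?ds) = 3"
    by code_simp
  ultimately show ?thesis
    by simp
qed

lemma icosahedron_chord_data:
  assumes "regular_icosahedron P" "inscribed_in_unit_sphere P"
  shows "chord_data P 12 5 ((2 ^ 22 / 5 ^ 5) ^ 6)"
proof -
  let ?ds = "replicate 5 (4, 0) @ replicate 5 (4, 4) @ [(8, 4)] :: zphi list"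
  have "chord_data P (2 * 6) (count_list ?ds (hd ?ds)) ((of_int (2 ^ 22) / of_int (5 ^ 5)) ^ 6)"
  proof (rule chord_data_zpoints[OF zregular_icosahedron _ _ _ _ _ _ _ _ _ _ assms(2)])
    show "zmul (zprod ?ds) (5 ^ 5, 0) = zmul (zprod (map (\<lambda>_. (2, 1)) ?ds)) (2 ^ 22, 0)"
      by code_simp
    show "length zicosahedron = 2 * 6"
      by code_simp
    show "y = 0" if y: "\<And>u v. u \<in> zpoint_val ` set zicosahedron \<Longrightarrow>
        v \<in> zpoint_val ` set zicosahedron \<Longrightarrow> u \<bullet> y = v \<bullet> y" for y
      using y[of "vector [golden_ratio, 0, 1]" "vector [golden_ratio, 0, -1]"]
        y[of "vector [1, golden_ratio, 0]" "vector [-1, golden_ratio, 0]"]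
        y[of "vector [0, 1, golden_ratio]" "vector [0, -1, golden_ratio]"]
      by (simp add: icosahedron_points cyclic_permutations_def inner_vector_3 vec_eq_iff forall_3)
    show "similar P (convex hull (zpoint_val ` set zicosahedron))"
      using assms(1) by (simp add: regular_icosahedron_def icosahedron_points)
  qed (use golden_ratio_bounds in simp_all)
  moreover have "count_list ?ds (hd ?ds) = 5"
    by code_simp
  ultimately show ?thesis
    by simp
qed

lemma dodecahedron_chord_data:
  assumes "regular_dodecahedron P" "inscribed_in_unit_sphere P"
  shows "chord_data P 20 3 ((2 ^ 44 / 3 ^ 18) ^ 10)"
proof -
  let ?ds = "replicate 3 (8, -4) @ replicate 6 (4, 0) @ replicate 6 (8, 0) @ replicate 3 (4, 4) @ [(12, 0)] :: zphi list"
  have "chord_data P (2 * 10) (count_list ?ds (hd ?ds)) ((of_int (2 ^ 44) / of_int (3 ^ 18)) ^ 10)"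
  proof (rule chord_data_zpoints[OF zregular_dodecahedron _ _ _ _ _ _ _ _ _ _ assms(2)])
    show "zmul (zprod ?ds) (3 ^ 18, 0) = zmul (zprod (map (\<lambda>_. (3, 0)) ?ds)) (2 ^ 44, 0)"
      by code_simp
    show "length zdodecahedron = 2 * 10"
      by code_simp
    show "y = 0" if y: "\<And>u v. u \<in> zpoint_val ` set zdodecahedron \<Longrightarrow>
        v \<in> zpoint_val ` set zdodecahedron \<Longrightarrow> u \<bullet> y = v \<bullet> y" for y
      using y[of "vector [1, 1, 1]" "vector [-1, 1, 1]"]
        y[of "vector [1, 1, 1]" "vector [1, -1, 1]"]
        y[of "vector [1, 1, 1]" "vector [1, 1, -1]"]
      by (simp add: dodecahedron_points cyclic_permutations_def cube_vertices_def inner_vector_3 vec_eq_iff forall_3)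
    show "similar P (convex hull (zpoint_val ` set zdodecahedron))"
      using assms(1) by (simp add: regular_dodecahedron_def dodecahedron_points)
  qed (use golden_ratio_bounds in simp_all)
  moreover have "count_list ?ds (hd ?ds) = 3"
    by code_simp
  ultimately show ?thesis
    by simp
qed

section \<open>Exponents and congruences\<close>

theorem theorem5p4:
  fixes P :: "(real^3) set" and V E :: nat
  assumes "regular_3_polytope P"
    and "inscribed_in_unit_sphere P"
    and "E = card (edges P)"
    and "V = card (vertices P)"
  shows "\<exists>\<nu> \<epsilon> :: nat.
    (\<forall>e\<in>edges P. card {v \<in> vertices P. v \<in> e} = \<nu>) \<and>
    (\<forall>v\<in>vertices P. card {e \<in> edges P. v \<in> e} = \<epsilon>) \<and>
    real E / real (gcd E V) = real (lcm E V) / real V \<and>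
    (\<forall>d\<in>{real \<epsilon>, real E / real (gcd E V)}.
      \<exists>a b :: nat. 0 < a \<and> 0 < b \<and>
        (\<Prod>c\<in>chords P. (chord_length c)\<^sup>2) = real \<nu> ^ a / d ^ b \<and>
        E dvd b \<and>
        (regular_tetrahedron P \<longrightarrow> [a = 0] (mod E) \<and> [a = E] (mod V)) \<and>
        (regular_octahedron P \<or> regular_cube P \<longrightarrow> [a = V] (mod E) \<and> [a = E] (mod V)) \<and>
        (regular_icosahedron P \<or> regular_dodecahedron P \<longrightarrow> [a = V] (mod E) \<and> [a = 0] (mod V)))"
proof -
  \<comment> \<open>The five cases exclude each other because the numbers of vertices differ, so in each case only one of the three
    congruence conditions is in force.\<close>
  have V: "regular_tetrahedron P \<Longrightarrow> V = 4" "regular_octahedron P \<Longrightarrow> V = 6" "regular_cube P \<Longrightarrow> V = 8"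
      "regular_icosahedron P \<Longrightarrow> V = 12" "regular_dodecahedron P \<Longrightarrow> V = 20"
    using tetrahedron_chord_data octahedron_chord_data cube_chord_data icosahedron_chord_data
      dodecahedron_chord_data assms(2,4) by (auto simp: chord_data_def)
  let ?good = "\<lambda>a. (regular_tetrahedron P \<longrightarrow> [a = 0] (mod E) \<and> [a = E] (mod V)) \<and>
        (regular_octahedron P \<or> regular_cube P \<longrightarrow> [a = V] (mod E) \<and> [a = E] (mod V)) \<and>
        (regular_icosahedron P \<or> regular_dodecahedron P \<longrightarrow> [a = V] (mod E) \<and> [a = 0] (mod V))"
  let ?C = "\<Prod>c\<in>chords P. (chord_length c)\<^sup>2"
  have quotient: "real E / real (gcd E V) = real (lcm E V) / real V" if "0 < V"
  proof -
    have "real (gcd E V) * real (lcm E V) = real E * real V"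
      by (metis of_nat_mult prod_gcd_lcm_nat)
    then show ?thesis
      using that by (simp add: field_simps)
  qed
  have claim: ?thesis
    if data: "chord_data P n \<epsilon> C" and n: "0 < n" 
      and d: "\<forall>d\<in>{real \<epsilon>, real E / real (gcd E V)}. \<exists>a b :: nat. 0 < a \<and> 0 < b \<and> C = 2 ^ a / d ^ b \<and> E dvd b \<and> ?good a"
    for n \<epsilon> C
  proof (rule exI[of _ 2], rule exI[of _ \<epsilon>], intro conjI)
    show "real E / real (gcd E V) = real (lcm E V) / real V"
      using quotient data n assms(4) by (simp add: chord_data_def)
  qed (use data d in \<open>simp_all add: chord_data_def\<close>)
  consider "regular_tetrahedron P" | "regular_octahedron P" | "regular_cube P"
    | "regular_icosahedron P" | "regular_dodecahedron P"
    using assms(1) by (auto simp: regular_3_polytope_def)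
  then show ?thesis
  proof cases
    case 1
    note data = tetrahedron_chord_data[OF 1 assms(2)]
    then have E: "E = 6"
      using assms(3) by (simp add: chord_data_def)
    have "gcd 6 4 = (2 :: nat)"
      by code_simp
    moreover have "((2 ^ 9 / 3 ^ 3) ^ 2 :: real) = 2 ^ 18 / 3 ^ 6"
      by (simp add: power_divide flip: power_mult)
    moreover have "?good 18"
      using V 1 by (auto simp: E cong_def)
    ultimately show ?thesis
      using V(1)[OF 1] by (intro claim[OF data] ballI exI[of _ 18] exI[of _ 6]) (auto simp: E)
  next
    case 2
    note data = octahedron_chord_data[OF 2 assms(2)]
    then have E: "E = 12"
      using assms(3) by (simp add: chord_data_def)
    have gcd: "gcd 12 6 = (6 :: nat)"
      by code_simp
    \<comment> \<open>The product is \<open>2^18\<close>. With \<open>b = 12\<close> the exponent \<open>a\<close> is \<open>18 + 2 * 12\<close> over powers of \<open>\<epsilon> = 4\<close> and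
      \<open>18 + 12\<close> over powers of \<open>E / gcd E V = 2\<close>.\<close>
    have "?good 42" "?good 30"
      using V 2 by (auto simp: E cong_def)
    moreover have "((2 ^ 6 / 1) ^ 3 :: real) = 2 ^ 42 / 4 ^ 12" "((2 ^ 6 / 1) ^ 3 :: real) = 2 ^ 30 / 2 ^ 12"
      by simp_all
    ultimately have "\<exists>a b :: nat. 0 < a \<and> 0 < b \<and> ((2 ^ 6 / 1) ^ 3 :: real) = 2 ^ a / d ^ b \<and> E dvd b \<and> ?good a"
      if "d = 4 \<or> d = 2" for d :: real
      using that
    proof (elim disjE)
      assume "d = 4"
      then show ?thesis
        using \<open>?good 42\<close> by (intro exI[of _ 42] exI[of _ 12]) (simp add: E)
    next
      assume "d = 2"
      then show ?thesis
        using \<open>?good 30\<close> by (intro exI[of _ 30] exI[of _ 12]) (simp add: E)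
    qed
    then show ?thesis
      using V(2)[OF 2] gcd by (intro claim[OF data]) (auto simp: E)
  next
    case 3
    note data = cube_chord_data[OF 3 assms(2)]
    then have E: "E = 12"
      using assms(3) by (simp add: chord_data_def)
    have "gcd 12 8 = (4 :: nat)"
      by code_simp
    moreover have "((2 ^ 17 / 3 ^ 6) ^ 4 :: real) = 2 ^ 68 / 3 ^ 24"
      by (simp add: power_divide flip: power_mult)
    moreover have "?good 68"
      using V 3 by (auto simp: E cong_def)
    ultimately show ?thesis
      using V(3)[OF 3] by (intro claim[OF data] ballI exI[of _ 68] exI[of _ 24]) (auto simp: E)
  next
    case 4
    note data = icosahedron_chord_data[OF 4 assms(2)]
    then have E: "E = 30"
      using assms(3) by (simp add: chord_data_def)
    have "gcd 30 12 = (6 :: nat)"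
      by code_simp
    moreover have "((2 ^ 22 / 5 ^ 5) ^ 6 :: real) = 2 ^ 132 / 5 ^ 30"
      by (simp add: power_divide flip: power_mult)
    moreover have "?good 132"
      using V 4 by (auto simp: E cong_def)
    ultimately show ?thesis
      using V(4)[OF 4] by (intro claim[OF data] ballI exI[of _ 132] exI[of _ 30]) (auto simp: E)
  next
    case 5
    note data = dodecahedron_chord_data[OF 5 assms(2)]
    then have E: "E = 30"
      using assms(3) by (simp add: chord_data_def)
    have "gcd 30 20 = (10 :: nat)"
      by code_simp
    moreover have "((2 ^ 44 / 3 ^ 18) ^ 10 :: real) = 2 ^ 440 / 3 ^ 180"
      by (simp add: power_divide flip: power_mult)
    moreover have "?good 440"
      using V 5 by (auto simp: E cong_def)
    ultimately show ?thesis
      using V(5)[OF 5] by (intro claim[OF data] ballI exI[of _ 440] exI[of _ 180]) (auto simp: E)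
  qed
qed

end
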